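(* There is a non-computable subsequence set for weak-$1$-genericity. That is, there is a non-computable set $I \subseteq \omega$ such that for every weak-$1$-generic set $G \subseteq \omega$, the set $G_I$ is also weak-$1$-generic.
   Context: Subsets of $\omega$ are identified with their characteristic functions, i.e. with elements of $2^{\omega}$. A set $S \subseteq 2^{<\omega}$ is dense if every $\sigma \in 2^{<\omega}$ has an extension in $S$. A set $G \subseteq \omega$ is weak-$1$-generic if for every dense c.e. set $S \subseteq 2^{<\omega}$, some initial segment of $G$ belongs to $S$. For an infinite set $I = \{i_0 < i_1 < i_2 < \cdots\} \subseteq \omega$, its principal function $P_I$ is defined by $P_I(n) = i_n$ for all $n \in \omega$. For $A \subseteq \omega$, the $I$-subsequence of $A$ is the set $A_I$ defined by $A_I(n) = A(P_I(n))$ for all $n \in \omega$. A set $I$ is a subsequence set for weak-$1$-genericity if for all $G \subseteq \omega$, if $G$ is weak-$1$-generic then $G_I$ is also weak-$1$-generic. *)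

theory Defs
  imports
    "HOL-Library.Infinite_Set"
    "HOL-Library.Nat_Bijection"
    "HOL-Library.Sublist"
begin

(* Codes for the partial recursive functions, by Kleene's schemes: the basic functions closed
   under composition, primitive recursion and unbounded minimization. *)
datatype recf =
    ZeroFn
  | SuccFn
  | Proj nat
  | Comp recf "recf list"
  | PrimRec recf recf
  | Mu recf

(* Codes carry no arity. A code denotes one partial function on argument lists of every length;
   its restriction to the lists of length k is a k-ary partial recursive function. The recursion
   variable of PrimRec and the search variable of Mu come first in the argument list. Composition
   is strict, and Mu diverges if its body diverges at an argument below the first zero. *)
fun rec_eval :: "recf \<Rightarrow> nat list \<Rightarrow> nat option" where
  "rec_eval ZeroFn xs = Some 0"
| "rec_eval SuccFn xs = (case xs of [] \<Rightarrow> None | x # _ \<Rightarrow> Some (Suc x))"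
| "rec_eval (Proj i) xs = (if i < length xs then Some (xs ! i) else None)"
| "rec_eval (Comp f gs) xs =
     (if \<forall>g \<in> set gs. rec_eval g xs \<noteq> None
      then rec_eval f (map (\<lambda>g. the (rec_eval g xs)) gs)
      else None)"
| "rec_eval (PrimRec f g) xs =
     (case xs of
        [] \<Rightarrow> None
      | n # ys \<Rightarrow>
          rec_nat (rec_eval f ys)
            (\<lambda>m r. case r of None \<Rightarrow> None | Some y \<Rightarrow> rec_eval g (m # y # ys)) n)"
| "rec_eval (Mu f) xs =
     (if \<exists>n. rec_eval f (n # xs) = Some 0 \<and> (\<forall>m<n. rec_eval f (m # xs) \<noteq> None)
      then Some (LEAST n. rec_eval f (n # xs) = Some 0)
      else None)"

definition computable_set :: "nat set \<Rightarrow> bool" where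
  "computable_set A \<longleftrightarrow> (\<exists>f. \<forall>n. rec_eval f [n] = Some (of_bool (n \<in> A)))"

(* A set is c.e. if it is the domain of a unary partial recursive function. *)
definition ce_set :: "nat set \<Rightarrow> bool" where
  "ce_set A \<longleftrightarrow> (\<exists>f. A = {n. rec_eval f [n] \<noteq> None})"

(* Binary strings are coded by natural numbers through the standard list coding. *)
definition string_code :: "bool list \<Rightarrow> nat" where
  "string_code \<sigma> = list_encode (map of_bool \<sigma>)"

definition ce_strings :: "bool list set \<Rightarrow> bool" where
  "ce_strings S \<longleftrightarrow> ce_set (string_code ` S)"

definition dense_strings :: "bool list set \<Rightarrow> bool" where
  "dense_strings S \<longleftrightarrow> (\<forall>\<sigma>. \<exists>\<tau> \<in> S. prefix \<sigma> \<tau>)"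

definition initial_segment :: "nat set \<Rightarrow> nat \<Rightarrow> bool list" where
  "initial_segment G n = map (\<lambda>i. i \<in> G) [0..<n]"

definition weak_1_generic :: "nat set \<Rightarrow> bool" where
  "weak_1_generic G \<longleftrightarrow>
     (\<forall>S. dense_strings S \<and> ce_strings S \<longrightarrow> (\<exists>n. initial_segment G n \<in> S))"

(* For infinite I, the library function enumerate I is the principal function of I; the definition
   is meaningful only for such I. *)
definition subsequence :: "nat set \<Rightarrow> nat set \<Rightarrow> nat set" where
  "subsequence I A = {n. enumerate I n \<in> A}"

definition subsequence_set_weak_1_generic :: "nat set \<Rightarrow> bool" where
  "subsequence_set_weak_1_generic I \<longleftrightarrow>
     infinite I \<and> (\<forall>G. weak_1_generic G \<longrightarrow> weak_1_generic (subsequence I G))"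

end

theory Submission
  imports Defs "HOL-Library.Countable"
begin

text \<open>
The subsequence set \<open>I\<close> is built so that its complement is very sparse and, for each single
computability task, predictably sparse.

Let \<open>S\<close> be dense and c.e. For every \<open>n\<close> there is a string \<open>\<rho>\<close> that works as a universal suffix:
\<open>\<mu> @ \<rho>\<close> extends an element of \<open>S\<close> for each of the finitely many strings \<open>\<mu>\<close> of length at most
\<open>n\<close>. It is found by treating the strings \<open>\<mu>\<close> one after the other, and a search makes it a
computable function \<open>\<rho>\<^sub>n\<close> of \<open>n\<close> (\<open>computable_universal_suffix\<close>). Now suppose that \<open>I\<close> contains the
whole interval from \<open>n\<close> to \<open>n + |\<rho>\<^sub>n|\<close>, and that \<open>G\<close> begins with \<open>\<sigma> @ \<rho>\<^sub>n\<close>, where \<open>|\<sigma>| = n\<close>. Then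
the \<open>I\<close>-subsequence of \<open>G\<close> begins with \<open>\<mu> @ \<rho>\<^sub>n\<close> for some \<open>\<mu>\<close> of length at most \<open>n\<close>, whatever \<open>I\<close>
looks like below \<open>n\<close>, so it meets \<open>S\<close>. If there is a computable infinite set of such \<open>n\<close>, then the
strings \<open>\<sigma> @ \<rho>\<^sub>n\<close> for these \<open>n\<close> form a dense c.e. set, which every weakly 1-generic \<open>G\<close> meets.

It is enough for this that all but finitely many elements of the complement of \<open>I\<close> belong to a
computable set whose gaps exceed the lengths \<open>|\<rho>\<^sub>n|\<close>. Any infinite computable set can be thinned out
to such a set (\<open>thin_out\<close>). Doing so successively for the countably many dense c.e. sets \<open>S\<close>
gives a decreasing sequence of infinite computable sets, the ranges of \<open>D 0, D 1, \<dots>\<close>. Choose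
\<open>p 0 < p 1 < \<dots>\<close> with \<open>p e\<close> in the range of \<open>D e\<close>. Every \<open>I\<close> whose complement consists of some of the
\<open>p e\<close> is then a subsequence set once it is infinite. As each \<open>p e\<close> may freely be left in \<open>I\<close> or
taken out, \<open>I\<close> can be made to differ from the \<open>e\<close>-th computable set at \<open>p e\<close>.

The recursion theory needed is that the computable functions and the semidecidable relations have
the usual closure properties. The delicate ones, closure of semidecidability under existential
quantification and the selection of witnesses by a computable function, require running
computations in parallel. This is achieved by total computable approximations to every partial
recursive function (\<open>ex_clock\<close>).
\<close>

section \<open>Total recursive functions\<close>

text \<open>
A code has no arity, so the arity is a parameter here. The function still takes the whole argument
list, so that closure rules compose as in \<open>\<lambda>xs. F xs + G xs\<close> and argument \<open>i\<close> is \<open>xs ! i\<close>.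
\<close>

definition total_rec :: "nat \<Rightarrow> (nat list \<Rightarrow> nat) \<Rightarrow> bool" where
  "total_rec k F \<longleftrightarrow> (\<exists>f. \<forall>xs. length xs = k \<longrightarrow> rec_eval f xs = Some (F xs))"

lemma total_rec_cong:
  assumes "total_rec k F" "\<And>xs. length xs = k \<Longrightarrow> F xs = G xs"
  shows "total_rec k G"
  using assms unfolding total_rec_def by metis

lemma total_rec_nth: "i < k \<Longrightarrow> total_rec k (\<lambda>xs. xs ! i)"
  unfolding total_rec_def by (rule exI[of _ "Proj i"]) simp

lemma total_rec_comp:
  assumes F: "total_rec (length Gs) F" and G: "\<And>G. G \<in> set Gs \<Longrightarrow> total_rec k G"
  shows "total_rec k (\<lambda>xs. F (map (\<lambda>G. G xs) Gs))"
proof -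
  obtain f where f: "\<And>xs. length xs = length Gs \<Longrightarrow> rec_eval f xs = Some (F xs)"
    using F unfolding total_rec_def by blast
  have "\<forall>G\<in>set Gs. \<exists>g. \<forall>xs. length xs = k \<longrightarrow> rec_eval g xs = Some (G xs)"
    using G unfolding total_rec_def by blast
  then obtain c where c: "\<And>G xs. G \<in> set Gs \<Longrightarrow> length xs = k \<Longrightarrow> rec_eval (c G) xs = Some (G xs)"
    by metis
  have "rec_eval (Comp f (map c Gs)) xs = Some (F (map (\<lambda>G. G xs) Gs))" if "length xs = k" for xs
  proof -
    have eq: "map (\<lambda>G. the (rec_eval (c G) xs)) Gs = map (\<lambda>G. G xs) Gs"
      using c that by simp
    then show ?thesis using c[OF _ that] f by (simp add: comp_def eq)
  qed
  then show ?thesis unfolding total_rec_def by blast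
qed

lemma drop_eq_map_nth: "length xs = j + k \<Longrightarrow> drop j xs = map (\<lambda>i. xs ! (j + i)) [0..<k]"
  by (rule nth_equalityI) auto

text \<open>
Substitution that touches only the front of the argument list: the first \<open>j\<close> arguments, which were
introduced by quantifiers or recursions, are replaced by the values of \<open>Gs\<close>, and the parameters
behind them are passed on.
\<close>

lemma total_rec_prepend:
  assumes F: "total_rec (length Gs + k) F" and G: "\<And>G. G \<in> set Gs \<Longrightarrow> total_rec (j + k) G"
  shows "total_rec (j + k) (\<lambda>xs. F (map (\<lambda>G. G xs) Gs @ drop j xs))"
proof (rule total_rec_cong)
  let ?Ps = "map (\<lambda>i xs. xs ! (j + i)) [0..<k]"
  show "total_rec (j + k) (\<lambda>xs. F (map (\<lambda>G. G xs) (Gs @ ?Ps)))"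
    by (rule total_rec_comp) (use F G in \<open>auto intro: total_rec_nth\<close>)
  show "F (map (\<lambda>G. G xs) (Gs @ ?Ps)) = F (map (\<lambda>G. G xs) Gs @ drop j xs)"
    if "length xs = j + k" for xs
    using drop_eq_map_nth[OF that] by (simp add: comp_def)
qed

lemma total_rec_drop: "total_rec k F \<Longrightarrow> total_rec (j + k) (\<lambda>xs. F (drop j xs))"
  using total_rec_prepend[of "[]" k F j] by simp

lemma total_rec_unary:
  "total_rec 1 (\<lambda>xs. h (xs ! 0)) \<Longrightarrow> total_rec k F \<Longrightarrow> total_rec k (\<lambda>xs. h (F xs))"
  using total_rec_comp[of "[F]" "\<lambda>xs. h (xs ! 0)" k] by simp

lemma total_rec_Suc: "total_rec k F \<Longrightarrow> total_rec k (\<lambda>xs. Suc (F xs))"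
  by (rule total_rec_unary, unfold total_rec_def, rule exI[of _ SuccFn])
    (auto split: list.split)

lemma total_rec_const: "total_rec k (\<lambda>xs. c)"
proof (induction c)
  case 0
  show ?case unfolding total_rec_def by (rule exI[of _ ZeroFn]) simp
qed (rule total_rec_Suc)

text \<open>
Primitive recursion along an arbitrary computable bound \<open>N\<close>. In the step function, positions 0
and 1 hold the counter and the previous value, and the parameters follow. The elementary functions
below are all obtained from this rule.
\<close>

lemma total_rec_rec:
  assumes F: "total_rec k F" and G: "total_rec (2 + k) (\<lambda>xs. G (xs ! 0) (xs ! 1) (drop 2 xs))"
    and N: "total_rec k N"
  shows "total_rec k (\<lambda>xs. rec_nat (F xs) (\<lambda>m y. G m y xs) (N xs))"
proof -
  obtain f where f: "\<And>xs. length xs = k \<Longrightarrow> rec_eval f xs = Some (F xs)"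
    using F unfolding total_rec_def by blast
  obtain g where g: "\<And>xs. length xs = 2 + k \<Longrightarrow>
      rec_eval g xs = Some (G (xs ! 0) (xs ! 1) (drop 2 xs))"
    using G unfolding total_rec_def by blast
  have "rec_eval (PrimRec f g) (n # xs) = Some (rec_nat (F xs) (\<lambda>m y. G m y xs) n)"
    if "length xs = k" for n xs
    using that by (induction n) (simp_all add: f g)
  then have "total_rec (1 + k) (\<lambda>xs. rec_nat (F (tl xs)) (\<lambda>m y. G m y (tl xs)) (hd xs))"
    unfolding total_rec_def by (intro exI[of _ "PrimRec f g"]) (auto simp: length_Suc_conv)
  from total_rec_prepend[of "[N]" k _ 0, simplified, OF this[simplified]] N
  show ?thesis by simp
qed

lemma total_rec_if:
  assumes "total_rec k A" "total_rec k B" "total_rec k C"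
  shows "total_rec k (\<lambda>xs. if A xs = 0 then B xs else C xs)"
proof (rule total_rec_cong)
  show "total_rec k (\<lambda>xs. rec_nat (B xs) (\<lambda>m y. C xs) (A xs))"
    by (rule total_rec_rec) (use assms total_rec_drop[of k C 2] in auto)
  show "rec_nat (B xs) (\<lambda>m y. C xs) (A xs) = (if A xs = 0 then B xs else C xs)" for xs
    by (cases "A xs") auto
qed

lemma total_rec_add:
  assumes "total_rec k F" "total_rec k G"
  shows "total_rec k (\<lambda>xs. F xs + G xs)"
proof (rule total_rec_cong)
  show "total_rec k (\<lambda>xs. rec_nat (F xs) (\<lambda>m y. Suc y) (G xs))"
    by (intro total_rec_rec total_rec_Suc total_rec_nth assms) auto
  have "rec_nat a (\<lambda>m y. Suc y) b = a + b" for a b by (induction b) auto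
  then show "rec_nat (F xs) (\<lambda>m y. Suc y) (G xs) = F xs + G xs" for xs .
qed

lemma total_rec_mult:
  assumes "total_rec k F" "total_rec k G"
  shows "total_rec k (\<lambda>xs. F xs * G xs)"
proof (rule total_rec_cong)
  show "total_rec k (\<lambda>xs. rec_nat 0 (\<lambda>m y. y + F xs) (G xs))"
    by (intro total_rec_rec total_rec_add total_rec_const total_rec_nth total_rec_drop assms) auto
  have "rec_nat 0 (\<lambda>m y. y + a) b = a * b" for a b :: nat by (induction b) auto
  then show "rec_nat 0 (\<lambda>m y. y + F xs) (G xs) = F xs * G xs" for xs .
qed

lemma total_rec_power:
  assumes "total_rec k F" "total_rec k G"
  shows "total_rec k (\<lambda>xs. F xs ^ G xs)"
proof (rule total_rec_cong)
  show "total_rec k (\<lambda>xs. rec_nat 1 (\<lambda>m y. y * F xs) (G xs))"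
    by (intro total_rec_rec total_rec_mult total_rec_const total_rec_nth total_rec_drop assms) auto
  have "rec_nat 1 (\<lambda>m y. y * a) b = a ^ b" for a b :: nat by (induction b) auto
  then show "rec_nat 1 (\<lambda>m y. y * F xs) (G xs) = F xs ^ G xs" for xs .
qed

lemma total_rec_pred:
  assumes "total_rec k F"
  shows "total_rec k (\<lambda>xs. F xs - 1)"
proof (rule total_rec_cong)
  show "total_rec k (\<lambda>xs. rec_nat 0 (\<lambda>m y. m) (F xs))"
    by (intro total_rec_rec total_rec_const total_rec_nth assms) auto
  show "rec_nat 0 (\<lambda>m y. m) (F xs) = F xs - 1" for xs by (cases "F xs") auto
qed

lemma total_rec_diff:
  assumes "total_rec k F" "total_rec k G"
  shows "total_rec k (\<lambda>xs. F xs - G xs)"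
proof (rule total_rec_cong)
  show "total_rec k (\<lambda>xs. rec_nat (F xs) (\<lambda>m y. y - 1) (G xs))"
    by (intro total_rec_rec total_rec_pred total_rec_nth assms) auto
  have "rec_nat a (\<lambda>m y. y - 1) b = a - b" for a b :: nat by (induction b) auto
  then show "rec_nat (F xs) (\<lambda>m y. y - 1) (G xs) = F xs - G xs" for xs .
qed

lemma total_rec_mod2:
  assumes "total_rec k F"
  shows "total_rec k (\<lambda>xs. F xs mod 2)"
proof (rule total_rec_cong)
  show "total_rec k (\<lambda>xs. rec_nat 0 (\<lambda>m y. 1 - y) (F xs))"
    by (intro total_rec_rec total_rec_diff total_rec_const total_rec_nth assms) auto
  have "rec_nat 0 (\<lambda>m y. 1 - y) a = a mod 2" for a :: nat
    by (induction a) (auto, presburger+)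
  then show "rec_nat 0 (\<lambda>m y. 1 - y) (F xs) = F xs mod 2" for xs .
qed

lemma total_rec_div2:
  assumes "total_rec k F"
  shows "total_rec k (\<lambda>xs. F xs div 2)"
proof (rule total_rec_cong)
  show "total_rec k (\<lambda>xs. rec_nat 0 (\<lambda>m y. y + m mod 2) (F xs))"
    by (intro total_rec_rec total_rec_add total_rec_mod2 total_rec_const total_rec_nth assms) auto
  have "rec_nat 0 (\<lambda>m y. y + m mod 2) a = a div 2" for a :: nat
    by (induction a) (auto, presburger+)
  then show "rec_nat 0 (\<lambda>m y. y + m mod 2) (F xs) = F xs div 2" for xs .
qed

lemma total_rec_div_power2:
  assumes "total_rec k F" "total_rec k G"
  shows "total_rec k (\<lambda>xs. F xs div 2 ^ G xs)"
proof (rule total_rec_cong)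
  show "total_rec k (\<lambda>xs. rec_nat (F xs) (\<lambda>m y. y div 2) (G xs))"
    by (intro total_rec_rec total_rec_div2 total_rec_nth assms) auto
  have "rec_nat a (\<lambda>m y. y div 2) b = a div 2 ^ b" for a b :: nat
    by (induction b) (auto simp: div_mult2_eq mult.commute[of 2])
  then show "rec_nat (F xs) (\<lambda>m y. y div 2) (G xs) = F xs div 2 ^ G xs" for xs .
qed

lemma total_rec_prod_encode:
  assumes "total_rec k F" "total_rec k G"
  shows "total_rec k (\<lambda>xs. prod_encode (F xs, G xs))"
  unfolding prod_encode_def triangle_def prod.case
  by (intro total_rec_add total_rec_mult total_rec_div2 total_rec_Suc assms)

text \<open>
A bounded product vanishes iff one of its factors does, so it expresses bounded search.
\<close>

lemma total_rec_prod:
  assumes F: "total_rec (Suc k) F" and N: "total_rec k N"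
  shows "total_rec k (\<lambda>xs. \<Prod>x<N xs. F (x # xs))"
proof (rule total_rec_cong)
  have "total_rec (2 + k) (\<lambda>xs. F (xs ! 0 # drop 2 xs))"
    using total_rec_prepend[of "[\<lambda>xs. xs ! 0]" k F 2] F total_rec_nth[of 0 "2 + k"] by simp
  then show "total_rec k (\<lambda>xs. rec_nat 1 (\<lambda>m y. y * F (m # xs)) (N xs))"
    by (intro total_rec_rec total_rec_mult total_rec_const total_rec_nth N) auto
  have "rec_nat 1 (\<lambda>m y. y * F (m # xs)) n = (\<Prod>x<n. F (x # xs))" for n xs
    by (induction n) auto
  then show "rec_nat 1 (\<lambda>m y. y * F (m # xs)) (N xs) = (\<Prod>x<N xs. F (x # xs))" for xs .
qed

lemma total_rec_Least:
  assumes F: "total_rec (Suc k) F" and ex: "\<And>xs. length xs = k \<Longrightarrow> \<exists>n. F (n # xs) = 0"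
  shows "total_rec k (\<lambda>xs. LEAST n. F (n # xs) = 0)"
proof -
  obtain f where f: "\<And>xs. length xs = Suc k \<Longrightarrow> rec_eval f xs = Some (F xs)"
    using F unfolding total_rec_def by blast
  have "rec_eval (Mu f) xs = Some (LEAST n. F (n # xs) = 0)" if "length xs = k" for xs
    using ex[OF that] that by (simp add: f)
  then show ?thesis unfolding total_rec_def by blast
qed

section \<open>Clocked evaluation\<close>

text \<open>
A total function \<open>C\<close> approximates \<open>\<phi>\<close> with the help of an additional first argument \<open>t\<close>, the clock.
The value 0 means that no result has been found by time \<open>t\<close>, and \<open>Suc y\<close> means the result \<open>y\<close>. The
approximation has to be correct at all times and successful at almost all times. Since finitely
many "almost all" conditions can be combined, this form is preserved by every recursion scheme without
arguing about monotonicity in \<open>t\<close>.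
\<close>

definition clocks :: "nat \<Rightarrow> (nat list \<Rightarrow> nat) \<Rightarrow> (nat list \<Rightarrow> nat option) \<Rightarrow> bool" where
  "clocks k C \<phi> \<longleftrightarrow> (\<forall>xs y. length xs = k \<longrightarrow>
     (\<forall>t. C (t # xs) = Suc y \<longrightarrow> \<phi> xs = Some y) \<and>
     (\<phi> xs = Some y \<longrightarrow> (\<forall>\<^sub>F t in sequentially. C (t # xs) = Suc y)))"

lemma clocks_sound: "clocks k C \<phi> \<Longrightarrow> C (t # xs) = Suc y \<Longrightarrow> length xs = k \<Longrightarrow> \<phi> xs = Some y"
  unfolding clocks_def by blast

lemma clocks_complete:
  "clocks k C \<phi> \<Longrightarrow> \<phi> xs = Some y \<Longrightarrow> length xs = k \<Longrightarrow>
    \<forall>\<^sub>F t in sequentially. C (t # xs) = Suc y"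
  unfolding clocks_def by blast

lemma ex_clock_total:
  assumes "total_rec k F" "\<And>xs. length xs = k \<Longrightarrow> \<phi> xs = Some (F xs)"
  shows "\<exists>C. total_rec (Suc k) C \<and> clocks k C \<phi>"
  using total_rec_Suc[OF total_rec_drop[OF assms(1), of 1]] assms(2)
  by (intro exI[of _ "\<lambda>xs. Suc (F (drop 1 xs))"]) (auto simp: clocks_def)

lemma ex_clock_empty:
  assumes "\<And>xs. length xs = k \<Longrightarrow> \<phi> xs = None"
  shows "\<exists>C. total_rec (Suc k) C \<and> clocks k C \<phi>"
  using assms by (intro exI[of _ "\<lambda>xs. 0"]) (auto simp: clocks_def total_rec_const)

text \<open>
All inner computations and the outer one run with the same clock. The product of the inner
approximations detects whether they have all succeeded.
\<close>

lemma ex_clock_Comp: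
  assumes f: "\<exists>C. total_rec (Suc (length gs)) C \<and> clocks (length gs) C (rec_eval f)"
    and g: "\<And>g. g \<in> set gs \<Longrightarrow> \<exists>C. total_rec (Suc k) C \<and> clocks k C (rec_eval g)"
  shows "\<exists>C. total_rec (Suc k) C \<and> clocks k C (rec_eval (Comp f gs))"
proof -
  obtain F where F: "total_rec (Suc (length gs)) F" "clocks (length gs) F (rec_eval f)"
    using f by blast
  obtain c where c: "\<And>g. g \<in> set gs \<Longrightarrow> total_rec (Suc k) (c g)"
      "\<And>g. g \<in> set gs \<Longrightarrow> clocks k (c g) (rec_eval g)"
    using g by metis
  define D where "D xs = prod_list (map (\<lambda>g. c g xs) gs)" for xs
  define C where "C xs = (if D xs = 0 then 0 else F (hd xs # map (\<lambda>g. c g xs - 1) gs))" for xs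
  have prod: "total_rec (Suc k) (\<lambda>xs. prod_list (map (\<lambda>g. c g xs) hs))" if "set hs \<subseteq> set gs" for hs
    using that by (induction hs) (auto intro: total_rec_const total_rec_mult c)
  have "total_rec (Suc k) (\<lambda>xs. F (map (\<lambda>G. G xs) ((\<lambda>xs. xs ! 0) # map (\<lambda>g xs. c g xs - 1) gs)))"
    by (rule total_rec_comp) (use F in \<open>auto intro: total_rec_nth total_rec_pred[simplified] c\<close>)
  then have "total_rec (Suc k) (\<lambda>xs. F (hd xs # map (\<lambda>g. c g xs - 1) gs))"
    by (rule total_rec_cong) (auto simp: comp_def length_Suc_conv)
  then have C: "total_rec (Suc k) C"
    unfolding C_def D_def using prod[of gs] by (intro total_rec_if total_rec_const) auto
  have "rec_eval (Comp f gs) xs = Some y" if "C (t # xs) = Suc y" "length xs = k" for t xs y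
  proof -
    have nz: "c g (t # xs) \<noteq> 0" if "g \<in> set gs" for g
      using \<open>C (t # xs) = Suc y\<close> that by (auto simp: C_def D_def prod_list_zero_iff split: if_splits)
    have g: "rec_eval g xs = Some (c g (t # xs) - 1)" if "g \<in> set gs" for g
      by (rule clocks_sound[OF c(2)[OF that], of t]) (use nz[OF that] \<open>length xs = k\<close> in auto)
    have eq: "map (\<lambda>g. the (rec_eval g xs)) gs = map (\<lambda>g. c g (t # xs) - 1) gs"
      using g by simp
    have "rec_eval f (map (\<lambda>g. c g (t # xs) - 1) gs) = Some y"
      by (rule clocks_sound[OF F(2), of t])
        (use that(1) in \<open>auto simp: C_def split: if_splits\<close>)
    then show ?thesis using g by (simp add: eq)
  qed
  moreover have "\<forall>\<^sub>F t in sequentially. C (t # xs) = Suc y"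
    if "rec_eval (Comp f gs) xs = Some y" "length xs = k" for xs y
  proof -
    have g: "\<exists>z. rec_eval g xs = Some z" if "g \<in> set gs" for g
      using that \<open>rec_eval (Comp f gs) xs = Some y\<close> by (auto split: if_splits)
    have f: "rec_eval f (map (\<lambda>g. the (rec_eval g xs)) gs) = Some y"
      using that(1) by (auto split: if_splits)
    have "\<forall>\<^sub>F t in sequentially. \<forall>g\<in>set gs. c g (t # xs) = Suc (the (rec_eval g xs))"
      using g clocks_complete[OF c(2) _ that(2)] by (intro eventually_ball_finite) force+
    moreover have "\<forall>\<^sub>F t in sequentially. F (t # map (\<lambda>g. the (rec_eval g xs)) gs) = Suc y"
      by (rule clocks_complete[OF F(2) f]) simp
    ultimately show ?thesis
    proof eventually_elim
      case (elim t)
      then have eq: "map (\<lambda>g. c g (t # xs) - 1) gs = map (\<lambda>g. the (rec_eval g xs)) gs" by simp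
      moreover have "D (t # xs) \<noteq> 0" using elim by (auto simp: D_def prod_list_zero_iff)
      ultimately show ?case using elim by (simp add: C_def eq del: One_nat_def)
    qed
  qed
  ultimately show ?thesis using C unfolding clocks_def by blast
qed

text \<open>
The recursion is carried out on the shifted values, and the value 0 for failure is passed on to the end.
\<close>

lemma ex_clock_PrimRec:
  assumes f: "\<exists>C. total_rec (Suc k) C \<and> clocks k C (rec_eval f)"
    and g: "\<exists>C. total_rec (Suc (2 + k)) C \<and> clocks (2 + k) C (rec_eval g)"
  shows "\<exists>C. total_rec (Suc (Suc k)) C \<and> clocks (Suc k) C (rec_eval (PrimRec f g))"
proof -
  obtain F where F: "total_rec (Suc k) F" "clocks k F (rec_eval f)" using f by blast
  obtain G where G: "total_rec (Suc (2 + k)) G" "clocks (2 + k) G (rec_eval g)" using g by blast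
  define h where "h ys t = rec_nat (F (t # ys)) (\<lambda>m y. if y = 0 then 0 else G (t # m # (y - 1) # ys))"
    for ys t
  define C where "C xs = h (drop 2 xs) (xs ! 0) (xs ! 1)" for xs
  have "total_rec (2 + k) (\<lambda>xs. F (xs ! 0 # drop 2 xs))"
    using total_rec_prepend[of "[\<lambda>xs. xs ! 0]" k F 2] F total_rec_nth[of 0 "2 + k"] by simp
  moreover have "total_rec (4 + k) (\<lambda>xs. G (xs ! 2 # xs ! 0 # (xs ! 1 - 1) # drop 4 xs))"
    using total_rec_prepend[of "[\<lambda>xs. xs ! 2, \<lambda>xs. xs ! 0, \<lambda>xs. xs ! 1 - 1]" k G 4] G
      total_rec_nth[of 2 "4 + k"] total_rec_nth[of 0 "4 + k"]
      total_rec_pred[OF total_rec_nth[of 1 "4 + k"]] by (auto simp: eval_nat_numeral)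
  then have "total_rec (2 + (2 + k))
      (\<lambda>xs. G (drop 2 xs ! 0 # xs ! 0 # (xs ! 1 - 1) # drop 2 (drop 2 xs)))"
    by (simp add: eval_nat_numeral) (erule total_rec_cong, auto)
  ultimately have C: "total_rec (2 + k) C"
    unfolding C_def h_def by (intro total_rec_rec total_rec_if total_rec_const total_rec_nth) auto
  let ?H = "\<lambda>ys n. rec_eval (PrimRec f g) (n # ys)"
  have "?H ys n = Some y" if "h ys t n = Suc y" "length ys = k" for t ys n y
    using that(1)
  proof (induction n arbitrary: y)
    case 0
    then show ?case using clocks_sound[OF F(2)] that(2) by (simp add: h_def)
  next
    case (Suc n)
    then obtain z where z: "h ys t n = Suc z" by (cases "h ys t n") (auto simp: h_def)
    then have "G (t # n # z # ys) = Suc y" using Suc.prems by (simp add: h_def)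
    then have "rec_eval g (n # z # ys) = Some y" using that(2) by (intro clocks_sound[OF G(2)]) auto
    then show ?case using Suc.IH[OF z] by simp
  qed
  moreover have "\<forall>\<^sub>F t in sequentially. h ys t n = Suc y"
    if "?H ys n = Some y" "length ys = k" for ys n y
    using that(1)
  proof (induction n arbitrary: y)
    case 0
    then show ?case using clocks_complete[OF F(2)] that(2) by (simp add: h_def)
  next
    case (Suc n)
    then obtain z where z: "?H ys n = Some z" "rec_eval g (n # z # ys) = Some y"
      by (auto split: option.splits)
    have "\<forall>\<^sub>F t in sequentially. G (t # n # z # ys) = Suc y"
      using that(2) z(2) by (intro clocks_complete[OF G(2)]) auto
    with Suc.IH[OF z(1)] show ?case
      by eventually_elim (simp add: h_def)
  qed
  ultimately have "clocks (Suc k) C (rec_eval (PrimRec f g))"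
    unfolding clocks_def C_def by (auto simp: length_Suc_conv simp del: rec_eval.simps)
  then show ?thesis using C by (auto simp: eval_nat_numeral)
qed

text \<open>
Unbounded search is cut off at the clock value, so the clock bounds both the search and the time of
each single test. Only this scheme needs an approximation at all; in the others the clock is merely
handed down.
\<close>

lemma ex_clock_Mu:
  assumes f: "\<exists>C. total_rec (Suc (Suc k)) C \<and> clocks (Suc k) C (rec_eval f)"
  shows "\<exists>C. total_rec (Suc k) C \<and> clocks k C (rec_eval (Mu f))"
proof -
  obtain F where F: "total_rec (Suc (Suc k)) F" "clocks (Suc k) F (rec_eval f)" using f by blast
  (* State of the search after n candidates: 0 while it is running, 1 if some test has failed
     to produce a result, and m + 2 if the first zero has been found at m. *)
  define h where "h xs t = rec_nat (0::nat) (\<lambda>m s. if s = 0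
     then if F (t # m # xs) = 0 then 1 else if F (t # m # xs) - 1 = 0 then Suc (Suc m) else 0
     else s)" for xs t
  define C where "C xs = h (drop 1 xs) (xs ! 0) (xs ! 0) - 1" for xs
  have "total_rec (3 + k) (\<lambda>xs. F (xs ! 2 # xs ! 0 # drop 3 xs))"
    using total_rec_prepend[of "[\<lambda>xs. xs ! 2, \<lambda>xs. xs ! 0]" k F 3] F
      total_rec_nth[of 2 "3 + k"] total_rec_nth[of 0 "3 + k"] by (auto simp: eval_nat_numeral)
  then have "total_rec (2 + Suc k) (\<lambda>xs. F (drop 2 xs ! 0 # xs ! 0 # drop 1 (drop 2 xs)))"
    by (simp add: eval_nat_numeral) (erule total_rec_cong, auto)
  then have C: "total_rec (Suc k) C"
    unfolding C_def h_def
    by (intro total_rec_pred total_rec_rec total_rec_if total_rec_const total_rec_nth total_rec_Suc)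
      auto
  have h0: "h xs t n = 0 \<longleftrightarrow> (\<forall>m<n. F (t # m # xs) > 1)" for xs t n
    by (induction n) (auto simp: h_def less_Suc_eq)
  have hS: "h xs t n = Suc (Suc m) \<longleftrightarrow>
      m < n \<and> F (t # m # xs) = 1 \<and> (\<forall>i<m. F (t # i # xs) > 1)" for xs t n m
  proof (induction n)
    case (Suc n)
    have "h xs t (Suc n) = (if h xs t n = 0
       then if F (t # n # xs) = 0 then 1 else if F (t # n # xs) - 1 = 0 then Suc (Suc n) else 0
       else h xs t n)" by (simp add: h_def)
    then show ?case using Suc h0[of xs t n]
      by (auto simp: less_Suc_eq split: if_splits)
  qed (simp add: h_def)
  have Ceq: "C (t # xs) = Suc m \<longleftrightarrow>
      m < t \<and> F (t # m # xs) = 1 \<and> (\<forall>i<m. F (t # i # xs) > 1)" for t xs m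
    using hS[of xs t t m] unfolding C_def by auto
  have "rec_eval (Mu f) xs = Some m" if C: "C (t # xs) = Suc m" and l: "length xs = k" for t xs m
  proof -
    have 0: "rec_eval f (m # xs) = Some 0"
      using C l unfolding Ceq by (intro clocks_sound[OF F(2), of t]) auto
    have pos: "\<exists>y. rec_eval f (i # xs) = Some (Suc y)" if "i < m" for i
    proof -
      have "F (t # i # xs) = Suc (Suc (F (t # i # xs) - 2))"
        using C \<open>i < m\<close> unfolding Ceq by fastforce
      from clocks_sound[OF F(2) this] l show ?thesis by auto
    qed
    have "(LEAST n. rec_eval f (n # xs) = Some 0) = m"
      using 0 pos by (intro Least_equality) (auto intro: leI dest!: pos)
    moreover have "\<exists>n. rec_eval f (n # xs) = Some 0 \<and> (\<forall>m<n. rec_eval f (m # xs) \<noteq> None)"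
      using 0 pos by (intro exI[of _ m]) auto
    ultimately show ?thesis by simp
  qed
  moreover have "\<forall>\<^sub>F t in sequentially. C (t # xs) = Suc m"
    if E: "rec_eval (Mu f) xs = Some m" and l: "length xs = k" for xs m
  proof -
    obtain n where n: "rec_eval f (n # xs) = Some 0" "\<forall>m<n. rec_eval f (m # xs) \<noteq> None"
      using E by (auto split: if_splits)
    have m: "m = (LEAST n. rec_eval f (n # xs) = Some 0)" using E by (auto split: if_splits)
    have "m \<le> n" unfolding m by (rule Least_le) (rule n)
    have "rec_eval f (m # xs) = Some 0" unfolding m by (rule LeastI) (rule n)
    from clocks_complete[OF F(2) this] l
    have "\<forall>\<^sub>F t in sequentially. F (t # m # xs) = 1" by simp
    moreover have "\<forall>\<^sub>F t in sequentially. F (t # i # xs) > 1" if "i < m" for i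
    proof -
      have "rec_eval f (i # xs) \<noteq> Some 0" using not_less_Least that unfolding m by blast
      moreover have "rec_eval f (i # xs) \<noteq> None" using n(2) that \<open>m \<le> n\<close> by auto
      ultimately obtain y where "rec_eval f (i # xs) = Some (Suc y)"
        by (metis not0_implies_Suc not_None_eq)
      from clocks_complete[OF F(2) this] l
      have "\<forall>\<^sub>F t in sequentially. F (t # i # xs) = Suc (Suc y)" by simp
      then show ?thesis by eventually_elim simp
    qed
    then have "\<forall>\<^sub>F t in sequentially. \<forall>i\<in>{..<m}. F (t # i # xs) > 1"
      by (intro eventually_ball_finite) auto
    moreover have "\<forall>\<^sub>F t in sequentially. m < t" by (rule eventually_gt_at_top)
    ultimately show ?thesis by eventually_elim (auto simp: Ceq)
  qed
  ultimately show ?thesis using C unfolding clocks_def by blast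
qed

text \<open>
If the argument list is too short for a code, the computation diverges, and the constant 0 approximates it.
\<close>

lemma ex_clock: "\<exists>C. total_rec (Suc k) C \<and> clocks k C (rec_eval f)"
proof (induction f arbitrary: k)
  case ZeroFn
  show ?case by (rule ex_clock_total[OF total_rec_const]) simp
next
  case SuccFn
  show ?case
  proof (cases k)
    case 0
    then show ?thesis by (intro ex_clock_empty) auto
  next
    case (Suc l)
    then show ?thesis
      by (intro ex_clock_total[OF total_rec_Suc[OF total_rec_nth[of 0]]]) (auto split: list.split)
  qed
next
  case (Proj i)
  show ?case
  proof (cases "i < k")
    case True
    show ?thesis by (rule ex_clock_total[OF total_rec_nth[OF True]]) (simp add: True)
  qed (intro ex_clock_empty, simp)
next
  case (Comp f gs)
  then show ?case by (intro ex_clock_Comp)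
next
  case (PrimRec f g)
  show ?case
  proof (cases k)
    case 0
    then show ?thesis by (intro ex_clock_empty) auto
  next
    case (Suc l)
    then show ?thesis using ex_clock_PrimRec[OF PrimRec] by (simp del: rec_eval.simps)
  qed
next
  case (Mu f)
  then show ?case by (intro ex_clock_Mu)
qed

section \<open>Semidecidable relations\<close>

definition semidecidable :: "nat \<Rightarrow> (nat list \<Rightarrow> bool) \<Rightarrow> bool" where
  "semidecidable k P \<longleftrightarrow> (\<exists>f. \<forall>xs. length xs = k \<longrightarrow> (rec_eval f xs \<noteq> None \<longleftrightarrow> P xs))"

lemma semidecidable_cong:
  assumes "semidecidable k P" "\<And>xs. length xs = k \<Longrightarrow> P xs \<longleftrightarrow> Q xs"
  shows "semidecidable k Q"
  using assms unfolding semidecidable_def by metis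

lemma semidecidable_ex_eq_0:
  assumes "total_rec (Suc k) F"
  shows "semidecidable k (\<lambda>xs. \<exists>n. F (n # xs) = 0)"
proof -
  obtain f where f: "\<And>xs. length xs = Suc k \<Longrightarrow> rec_eval f xs = Some (F xs)"
    using assms unfolding total_rec_def by auto
  show ?thesis unfolding semidecidable_def by (rule exI[of _ "Mu f"]) (simp add: f)
qed

lemma semidecidable_eq_0: "total_rec k F \<Longrightarrow> semidecidable k (\<lambda>xs. F xs = 0)"
  using semidecidable_ex_eq_0[of k "\<lambda>xs. F (drop 1 xs)"] total_rec_drop[of k F 1] by simp

lemma semidecidable_le:
  assumes "total_rec k F" "total_rec k G"
  shows "semidecidable k (\<lambda>xs. F xs \<le> G xs)"
  using semidecidable_eq_0[OF total_rec_diff[OF assms]] by simp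

lemma semidecidable_conj:
  assumes "semidecidable k P" "semidecidable k Q"
  shows "semidecidable k (\<lambda>xs. P xs \<and> Q xs)"
proof -
  obtain p where p: "\<And>xs. length xs = k \<Longrightarrow> rec_eval p xs \<noteq> None \<longleftrightarrow> P xs"
    using assms(1) unfolding semidecidable_def by blast
  obtain q where q: "\<And>xs. length xs = k \<Longrightarrow> rec_eval q xs \<noteq> None \<longleftrightarrow> Q xs"
    using assms(2) unfolding semidecidable_def by blast
  have "rec_eval (Comp ZeroFn [p, q]) xs \<noteq> None \<longleftrightarrow> P xs \<and> Q xs" if "length xs = k" for xs
    using p[OF that] q[OF that] by simp
  then show ?thesis unfolding semidecidable_def by blast
qed

lemma semidecidable_eq:
  assumes "total_rec k F" "total_rec k G"
  shows "semidecidable k (\<lambda>xs. F xs = G xs)"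
  by (rule semidecidable_cong[OF semidecidable_conj[OF semidecidable_le[OF assms]
        semidecidable_le[OF assms(2,1)]]]) auto

lemma semidecidable_ce_set:
  assumes "ce_set A" "total_rec k F"
  shows "semidecidable k (\<lambda>xs. F xs \<in> A)"
proof -
  obtain a where a: "A = {n. rec_eval a [n] \<noteq> None}" using assms(1) unfolding ce_set_def by blast
  obtain f where f: "\<And>xs. length xs = k \<Longrightarrow> rec_eval f xs = Some (F xs)"
    using assms(2) unfolding total_rec_def by blast
  show ?thesis unfolding semidecidable_def by (rule exI[of _ "Comp a [f]"]) (simp add: f a)
qed

text \<open>
A primitive recursion over \<open>x < N xs\<close> whose step ignores the previous value and evaluates \<open>P\<close> at
\<open>x\<close> converges iff all of these evaluations converge.
\<close>

lemma semidecidable_all_less: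
  assumes P: "semidecidable (Suc k) P" and N: "total_rec k N"
  shows "semidecidable k (\<lambda>xs. \<forall>x<N xs. P (x # xs))"
proof -
  obtain p where p: "\<And>xs. length xs = Suc k \<Longrightarrow> rec_eval p xs \<noteq> None \<longleftrightarrow> P xs"
    using P unfolding semidecidable_def by blast
  obtain n where n: "\<And>xs. length xs = k \<Longrightarrow> rec_eval n xs = Some (N xs)"
    using N unfolding total_rec_def by blast
  define q where "q = Comp p (Proj 0 # map (\<lambda>i. Proj (2 + i)) [0..<k])"
  have q: "rec_eval q (m # y # xs) = rec_eval p (m # xs)" if "length xs = k" for m y xs
  proof -
    have "map (\<lambda>i. xs ! i) [0..<k] = xs" using that map_nth by blast
    moreover have "map (\<lambda>i. the (if i < k then Some ((m # y # xs) ! Suc (Suc i)) else None)) [0..<k] =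
        map (\<lambda>i. xs ! i) [0..<k]" by simp
    ultimately show ?thesis using that by (simp add: q_def comp_def)
  qed
  have "rec_eval (PrimRec ZeroFn q) (b # xs) \<noteq> None \<longleftrightarrow> (\<forall>x<b. P (x # xs))"
    if l: "length xs = k" for b xs
  proof (induction b)
    case (Suc b)
    have "rec_eval (PrimRec ZeroFn q) (Suc b # xs) \<noteq> None \<longleftrightarrow>
        rec_eval (PrimRec ZeroFn q) (b # xs) \<noteq> None \<and> rec_eval p (b # xs) \<noteq> None"
      using q[OF l] by (auto split: option.splits)
    then show ?case using Suc p[of "b # xs"] l
      by (auto simp: less_Suc_eq simp del: rec_eval.simps)
  qed simp
  note q_iff = this
  have "rec_eval (Comp (PrimRec ZeroFn q) (n # map Proj [0..<k])) xs \<noteq> None \<longleftrightarrow>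
      (\<forall>x<N xs. P (x # xs))" if l: "length xs = k" for xs
  proof -
    have "map (\<lambda>i. the (if i < k then Some (xs ! i) else None)) [0..<k] = map (\<lambda>i. xs ! i) [0..<k]"
      by simp
    also have "\<dots> = xs" using l map_nth by blast
    finally have "rec_eval (Comp (PrimRec ZeroFn q) (n # map Proj [0..<k])) xs =
        rec_eval (PrimRec ZeroFn q) (N xs # xs)"
      using l n[OF l] by (simp add: comp_def)
    with q_iff[OF l] show ?thesis by presburger
  qed
  then show ?thesis unfolding semidecidable_def by blast
qed

text \<open>
Passing to \<open>1 - C\<close> makes acceptance the value 0, so that products and minimization apply directly.
\<close>

lemma semidecidable_approx:
  assumes "semidecidable k P"
  obtains C where "total_rec (Suc k) C"
    and "\<And>t xs. length xs = k \<Longrightarrow> C (t # xs) = 0 \<Longrightarrow> P xs"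
    and "\<And>xs. length xs = k \<Longrightarrow> P xs \<Longrightarrow> \<forall>\<^sub>F t in sequentially. C (t # xs) = 0"
proof -
  obtain p where p: "\<And>xs. length xs = k \<Longrightarrow> rec_eval p xs \<noteq> None \<longleftrightarrow> P xs"
    using assms unfolding semidecidable_def by blast
  obtain C where C: "total_rec (Suc k) C" "clocks k C (rec_eval p)" using ex_clock by blast
  show ?thesis
  proof (rule that)
    show "total_rec (Suc k) (\<lambda>xs. 1 - C xs)" by (intro total_rec_diff total_rec_const C)
    show "P xs" if "length xs = k" "1 - C (t # xs) = 0" for t xs
    proof -
      obtain y where "C (t # xs) = Suc y" using \<open>1 - C (t # xs) = 0\<close> by (cases "C (t # xs)") auto
      from clocks_sound[OF C(2) this that(1)] p[OF that(1)] show ?thesis by auto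
    qed
    show "\<forall>\<^sub>F t in sequentially. 1 - C (t # xs) = 0" if l: "length xs = k" and "P xs" for xs
    proof -
      obtain y where "rec_eval p xs = Some y" using p[OF l] \<open>P xs\<close> by auto
      from clocks_complete[OF C(2) this l] show ?thesis by eventually_elim simp
    qed
  qed
qed

lemma total_rec_bounded_search:
  assumes "total_rec (Suc (Suc k)) C"
  shows "total_rec (Suc k) (\<lambda>xs. \<Prod>n<xs ! 0. C (xs ! 0 # n # drop 1 xs))"
proof -
  have "total_rec (2 + k) (\<lambda>xs. C (xs ! 1 # xs ! 0 # drop 2 xs))"
    using total_rec_prepend[of "[\<lambda>xs. xs ! 1, \<lambda>xs. xs ! 0]" k C 2] assms
      total_rec_nth[of 1 "2 + k"] total_rec_nth[of 0 "2 + k"] by (auto simp: eval_nat_numeral)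
  then have "total_rec (Suc (Suc k)) (\<lambda>xs. C (xs ! 1 # xs ! 0 # drop 2 xs))" by simp
  from total_rec_prod[OF this total_rec_nth[of 0]] show ?thesis
    by (simp add: eval_nat_numeral)
qed

text \<open>
Dovetailing: stage \<open>t\<close> tests the candidates \<open>n < t\<close> with clock \<open>t\<close>. Since a valid candidate is accepted
at almost all times, it is accepted at some time beyond \<open>n\<close>.
\<close>

lemma ex_iff_bounded_search:
  assumes sound: "\<And>t n. C (t # n # xs) = 0 \<Longrightarrow> P n"
    and complete: "\<And>n. P n \<Longrightarrow> \<forall>\<^sub>F t in sequentially. C (t # n # xs) = 0"
  shows "(\<exists>n. P n) \<longleftrightarrow> (\<exists>t. (\<Prod>n<t. C (t # n # xs)) = (0::nat))"
proof
  assume "\<exists>n. P n"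
  then obtain n where "P n" by blast
  have "\<forall>\<^sub>F t in sequentially. C (t # n # xs) = 0 \<and> n < t"
    by (intro eventually_conj complete \<open>P n\<close> eventually_gt_at_top)
  then obtain t where "C (t # n # xs) = 0" "n < t"
    by (auto simp: eventually_sequentially)
  then show "\<exists>t. (\<Prod>n<t. C (t # n # xs)) = 0" by (auto)
next
  assume "\<exists>t. (\<Prod>n<t. C (t # n # xs)) = 0"
  then show "\<exists>n. P n" by (auto intro: sound)
qed

lemma semidecidable_ex:
  assumes "semidecidable (Suc k) P"
  shows "semidecidable k (\<lambda>xs. \<exists>n. P (n # xs))"
proof -
  obtain C where C: "total_rec (Suc (Suc k)) C"
      "\<And>t xs. length xs = Suc k \<Longrightarrow> C (t # xs) = 0 \<Longrightarrow> P xs"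
      "\<And>xs. length xs = Suc k \<Longrightarrow> P xs \<Longrightarrow> \<forall>\<^sub>F t in sequentially. C (t # xs) = 0"
    using semidecidable_approx[OF assms] by blast
  show ?thesis
  proof (rule semidecidable_cong[OF semidecidable_ex_eq_0[OF total_rec_bounded_search[OF C(1)]]])
    fix xs :: "nat list" assume "length xs = k"
    then show "(\<exists>t. (\<Prod>n<(t # xs) ! 0. C ((t # xs) ! 0 # n # drop 1 (t # xs))) = 0) \<longleftrightarrow>
        (\<exists>n. P (n # xs))"
      using ex_iff_bounded_search[of C xs "\<lambda>n. P (n # xs)"] C(2,3) by simp
  qed
qed

text \<open>
A computable choice of witnesses takes two searches: the first finds a stage \<open>T\<close> at which some
witness has been accepted, the second the least witness accepted at that stage.
\<close>

lemma semidecidable_uniformize: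
  assumes P: "semidecidable (Suc k) P" and ex: "\<And>xs. length xs = k \<Longrightarrow> \<exists>n. P (n # xs)"
  obtains F where "total_rec k F" and "\<And>xs. length xs = k \<Longrightarrow> P (F xs # xs)"
proof -
  obtain C where C: "total_rec (Suc (Suc k)) C"
      "\<And>t xs. length xs = Suc k \<Longrightarrow> C (t # xs) = 0 \<Longrightarrow> P xs"
      "\<And>xs. length xs = Suc k \<Longrightarrow> P xs \<Longrightarrow> \<forall>\<^sub>F t in sequentially. C (t # xs) = 0"
    using semidecidable_approx[OF P] by blast
  let ?B = "\<lambda>xs. \<Prod>n<xs ! 0. C (xs ! 0 # n # drop 1 xs)"
  define T where "T xs = (LEAST t. ?B (t # xs) = 0)" for xs
  define F where "F xs = (LEAST n. C (T (drop 1 (n # xs)) # n # drop 1 (n # xs)) = 0)" for xs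
  have exB: "\<exists>t. ?B (t # xs) = 0" if "length xs = k" for xs
    using ex_iff_bounded_search[of C xs "\<lambda>n. P (n # xs)"] C(2,3) ex[OF that] that by simp
  have T: "total_rec k T"
    unfolding T_def by (rule total_rec_Least[OF total_rec_bounded_search[OF C(1)] exB])
  have exC: "\<exists>n. C (T xs # n # xs) = 0" if "length xs = k" for xs
  proof -
    have "?B (T xs # xs) = 0" unfolding T_def by (rule LeastI_ex[OF exB[OF that]])
    then show ?thesis by (auto)
  qed
  show ?thesis
  proof (rule that)
    have "total_rec (1 + k) (\<lambda>xs. C (T (drop 1 xs) # xs ! 0 # drop 1 xs))"
      using total_rec_prepend[of "[\<lambda>xs. T (drop 1 xs), \<lambda>xs. xs ! 0]" k C 1] C(1)
        total_rec_drop[OF T, of 1] total_rec_nth[of 0 "1 + k"] by (auto simp: eval_nat_numeral)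
    then have "total_rec (Suc k) (\<lambda>xs. C (T (drop 1 xs) # xs ! 0 # drop 1 xs))" by simp
    from total_rec_Least[OF this] exC show "total_rec k F" unfolding F_def by simp
    show "P (F xs # xs)" if "length xs = k" for xs
    proof (rule C(2))
      show "C (T xs # F xs # xs) = 0" using LeastI_ex[OF exC[OF that]] unfolding F_def by simp
    qed (use that in simp)
  qed
qed

lemma ce_set_iff_semidecidable: "ce_set A \<longleftrightarrow> semidecidable 1 (\<lambda>xs. xs ! 0 \<in> A)"
proof -
  have "A = {n. rec_eval f [n] \<noteq> None} \<longleftrightarrow>
      (\<forall>xs. length xs = 1 \<longrightarrow> (rec_eval f xs \<noteq> None \<longleftrightarrow> xs ! 0 \<in> A))" for f
    unfolding One_nat_def length_Suc_conv by (auto simp: set_eq_iff simp del: not_None_eq)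
  then show ?thesis unfolding ce_set_def semidecidable_def by simp
qed

section \<open>Binary strings as numerals\<close>

text \<open>
The \<open>i\<close> lowest binary digits of \<open>v\<close>, the least significant one first. In this order appending a
string means adding a multiple of a power of two, and taking a prefix means reading fewer digits, so
the string operations become arithmetic and no coded list ever has to be decoded.
\<close>

fun bits :: "nat \<Rightarrow> nat \<Rightarrow> bool list" where
  "bits 0 v = []"
| "bits (Suc i) v = odd v # bits i (v div 2)"

lemma length_bits [simp]: "length (bits i v) = i"
  by (induction i arbitrary: v) auto

lemma bits_add: "bits (i + j) v = bits i v @ bits j (v div 2 ^ i)"
  by (induction i arbitrary: v) (auto simp: div_mult2_eq)

lemma take_bits: "i \<le> j \<Longrightarrow> take i (bits j v) = bits i v"
  using bits_add[of i "j - i" v] by simp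

lemma bits_append: "v < 2 ^ i \<Longrightarrow> bits (i + j) (v + 2 ^ i * m) = bits i v @ bits j m"
proof (induction i arbitrary: v)
  case (Suc i)
  have "(v + 2 ^ Suc i * m) div 2 = v div 2 + 2 ^ i * m"
    by (simp add: mult.assoc div_add1_eq)
  then show ?case using Suc.IH[of "v div 2"] Suc.prems by simp
qed simp

lemma ex_bits: "\<exists>v<2 ^ length \<sigma>. bits (length \<sigma>) v = \<sigma>"
proof (induction \<sigma>)
  case (Cons b \<sigma>)
  then obtain v where "v < 2 ^ length \<sigma>" "bits (length \<sigma>) v = \<sigma>" by blast
  then show ?case by (intro exI[of _ "of_bool b + 2 * v"]) auto
qed simp

lemma inj_string_code: "inj string_code"
proof (rule injI)
  fix \<sigma> \<tau> assume "string_code \<sigma> = string_code \<tau>"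
  then have "map of_bool \<sigma> = (map of_bool \<tau> :: nat list)"
    by (simp add: string_code_def list_encode_eq)
  moreover have "inj (of_bool :: bool \<Rightarrow> nat)" by (auto simp: inj_def of_bool_def split: if_splits)
  ultimately show "\<sigma> = \<tau>" using map_injective by blast
qed

text \<open>
A list code is built from the end of the list. The recursion therefore starts with the highest digit,
and its value after \<open>i\<close> steps is the code of the last \<open>i\<close> digits.
\<close>

lemma total_rec_string_code_bits:
  assumes "total_rec k F" "total_rec k G"
  shows "total_rec k (\<lambda>xs. string_code (bits (F xs) (G xs)))"
proof (rule total_rec_cong)
  let ?R = "\<lambda>l v. rec_nat 0 (\<lambda>i y. Suc (prod_encode ((v div 2 ^ (l - Suc i)) mod 2, y)))"
  show "total_rec k (\<lambda>xs. ?R (F xs) (G xs) (F xs))"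
    by (intro total_rec_rec total_rec_Suc total_rec_prod_encode total_rec_mod2 total_rec_div_power2
        total_rec_diff total_rec_const total_rec_nth total_rec_drop assms) auto
  have "?R l v i = string_code (bits i (v div 2 ^ (l - i)))" if "i \<le> l" for l v i
    using that
  proof (induction i)
    case (Suc i)
    have "2 ^ (l - i) = 2 ^ (l - Suc i) * (2::nat)"
      using Suc.prems by (metis Suc_diff_Suc Suc_le_lessD power_Suc2)
    then show ?case using Suc
      by (simp add: string_code_def div_mult2_eq of_bool_odd_eq_mod_2)
  qed (simp add: string_code_def)
  then show "?R (F xs) (G xs) (F xs) = string_code (bits (F xs) (G xs))" for xs by simp
qed

section \<open>Computable universal suffixes\<close>

text \<open>
The strings of \<open>M\<close> are served one by one. The suffix may always be lengthened, since this preserves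
what has been achieved for the earlier strings.
\<close>

lemma ex_universal_suffix:
  assumes "dense_strings S" "finite M"
  shows "\<exists>\<rho>. \<forall>\<mu>\<in>M. \<exists>p\<in>S. prefix p (\<mu> @ \<rho>)"
  using assms(2)
proof (induction M)
  case (insert \<nu> M)
  then obtain \<rho> where \<rho>: "\<forall>\<mu>\<in>M. \<exists>p\<in>S. prefix p (\<mu> @ \<rho>)" by blast
  obtain \<tau> where "\<tau> \<in> S" "prefix (\<nu> @ \<rho>) \<tau>" using assms(1) unfolding dense_strings_def by blast
  then obtain \<rho>' where \<tau>: "\<tau> = (\<nu> @ \<rho>) @ \<rho>'" by (auto elim: prefixE)
  have "\<exists>p\<in>S. prefix p (\<mu> @ \<rho> @ \<rho>')" if "\<mu> \<in> insert \<nu> M" for \<mu>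
    using that \<rho> \<tau> \<open>\<tau> \<in> S\<close> by (metis append.assoc insertE prefix_order.refl prefix_prefix)
  then show ?case by blast
qed simp

text \<open>
The suffix is \<open>bits (r n) (r n)\<close>, a string whose length and digits are given by the same number, so
that a single number is searched for. This is no loss of generality: a digit 1 and zeros
after it may be appended to any suffix.
\<close>

lemma computable_universal_suffix:
  assumes S: "dense_strings S" "ce_strings S"
  obtains r where "total_rec 1 (\<lambda>xs. r (xs ! 0))"
    and "\<And>n \<mu>. length \<mu> \<le> n \<Longrightarrow> \<exists>p\<in>S. prefix p (\<mu> @ bits (r n) (r n))"
proof -
  (* Here j and v run through the strings of length at most n, and i through the lengths of the
     prefixes of the extended string, whose numeral is v + 2 ^ j * m. *)
  define R where "R m n \<longleftrightarrow> (\<forall>j<Suc n. \<forall>v<2 ^ j. \<exists>i. i \<le> j + m \<and>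
    string_code (bits i (v + 2 ^ j * m)) \<in> string_code ` S)" for m n
  have R_iff: "R m n \<longleftrightarrow> (\<forall>\<mu>. length \<mu> \<le> n \<longrightarrow> (\<exists>p\<in>S. prefix p (\<mu> @ bits m m)))" for m n
  proof -
    have "(\<exists>i. i \<le> j + m \<and> string_code (bits i (v + 2 ^ j * m)) \<in> string_code ` S) \<longleftrightarrow>
        (\<exists>p\<in>S. prefix p (bits j v @ bits m m))" if "v < 2 ^ j" for j v
    proof -
      have *: "bits j v @ bits m m = bits (j + m) (v + 2 ^ j * m)" using bits_append[OF that] by simp
      have "prefix p (bits (j + m) w) \<longleftrightarrow> (\<exists>i\<le>j + m. p = bits i w)" for p w
      proof
        assume p: "prefix p (bits (j + m) w)"
        then have "length p \<le> j + m" using prefix_length_le by fastforce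
        moreover have "p = take (length p) (bits (j + m) w)" using p by (auto elim: prefixE)
        ultimately show "\<exists>i\<le>j + m. p = bits i w" using take_bits by metis
      next
        assume "\<exists>i\<le>j + m. p = bits i w"
        then show "prefix p (bits (j + m) w)" using take_bits take_is_prefix by metis
      qed
      then show ?thesis unfolding * by (auto simp: inj_image_mem_iff[OF inj_string_code])
    qed
    then have "R m n \<longleftrightarrow> (\<forall>j<Suc n. \<forall>v<2 ^ j. \<exists>p\<in>S. prefix p (bits j v @ bits m m))"
      unfolding R_def by simp
    also have "\<dots> \<longleftrightarrow> (\<forall>\<mu>. length \<mu> \<le> n \<longrightarrow> (\<exists>p\<in>S. prefix p (\<mu> @ bits m m)))"
    proof (intro iffI allI impI)
      fix \<mu> :: "bool list"
      assume *: "\<forall>j<Suc n. \<forall>v<2 ^ j. \<exists>p\<in>S. prefix p (bits j v @ bits m m)" and "length \<mu> \<le> n"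
      obtain v where v: "v < 2 ^ length \<mu>" "bits (length \<mu>) v = \<mu>" using ex_bits by blast
      from *[rule_format, of "length \<mu>" v] v \<open>length \<mu> \<le> n\<close>
      show "\<exists>p\<in>S. prefix p (\<mu> @ bits m m)" by simp
    qed simp
    finally show ?thesis .
  qed
  have "\<exists>m. R m n" for n
  proof -
    have "finite {\<mu> :: bool list. length \<mu> \<le> n}"
      using finite_lists_length_le[of "UNIV :: bool set" n] by simp
    from ex_universal_suffix[OF S(1) this] obtain \<rho>
      where \<rho>: "\<And>\<mu>. length \<mu> \<le> n \<Longrightarrow> \<exists>p\<in>S. prefix p (\<mu> @ \<rho>)" by auto
    obtain v where v: "v < 2 ^ length \<rho>" "bits (length \<rho>) v = \<rho>" using ex_bits by blast
    (* The digit 1 at position length rho makes m at least length rho, so the first m digits of m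
       include all of rho. *)
    define m where "m = v + 2 ^ length \<rho>"
    have m: "m = length \<rho> + (m - length \<rho>)"
      unfolding m_def by (simp add: less_imp_le trans_le_add2)
    have "bits (length \<rho> + (m - length \<rho>)) m = \<rho> @ bits (m - length \<rho>) 1"
      using bits_append[OF v(1), of _ 1] v(2) unfolding m_def by simp
    then have "prefix \<rho> (bits m m)" unfolding m[symmetric] by simp
    then have "prefix (\<mu> @ \<rho>) (\<mu> @ bits m m)" for \<mu> by simp
    then show ?thesis unfolding R_iff using \<rho> prefix_order.trans by blast
  qed
  moreover have "semidecidable 2 (\<lambda>xs. R (xs ! 0) (xs ! 1))"
  proof -
    (* The argument list is [i, v, j, m, n]; each quantifier removes its first entry. *)
    have "semidecidable (Suc (Suc (Suc 2))) (\<lambda>xs. xs ! 0 \<le> xs ! 2 + xs ! 3 \<and>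
        string_code (bits (xs ! 0) (xs ! 1 + 2 ^ (xs ! 2) * xs ! 3)) \<in> string_code ` S)"
      using S(2) unfolding ce_strings_def
      by (intro semidecidable_conj semidecidable_le semidecidable_ce_set total_rec_string_code_bits
          total_rec_add total_rec_mult total_rec_power total_rec_const total_rec_nth) auto
    from semidecidable_ex[OF this]
    have "semidecidable (Suc (Suc 2)) (\<lambda>xs. \<exists>i. i \<le> xs ! 1 + xs ! 2 \<and>
        string_code (bits i (xs ! 0 + 2 ^ (xs ! 1) * xs ! 2)) \<in> string_code ` S)"
      by (simp add: numeral_3_eq_3 numeral_2_eq_2)
    from semidecidable_all_less[OF this, of "\<lambda>xs. 2 ^ (xs ! 0)"]
    have "semidecidable (Suc 2) (\<lambda>xs. \<forall>v<2 ^ (xs ! 0). \<exists>i. i \<le> xs ! 0 + xs ! 1 \<and>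
        string_code (bits i (v + 2 ^ (xs ! 0) * xs ! 1)) \<in> string_code ` S)"
      by (simp add: numeral_2_eq_2 total_rec_power total_rec_const total_rec_nth)
    from semidecidable_all_less[OF this, of "\<lambda>xs. Suc (xs ! 1)"]
    show ?thesis
      by (simp add: R_def numeral_2_eq_2 total_rec_Suc total_rec_nth)
  qed
  ultimately obtain F where F: "total_rec 1 F" "\<And>xs. length xs = 1 \<Longrightarrow> R (F xs) (xs ! 0)"
    using semidecidable_uniformize[of 1 "\<lambda>xs. R (xs ! 0) (xs ! 1)"]
    by (auto simp: numeral_2_eq_2)
  show ?thesis
  proof (rule that)
    show "total_rec 1 (\<lambda>xs. F [xs ! 0])"
      by (rule total_rec_cong[OF F(1)]) (auto simp: length_Suc_conv)
    show "\<exists>p\<in>S. prefix p (\<mu> @ bits (F [n]) (F [n]))" if "length \<mu> \<le> n" for n \<mu>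
      using F(2)[of "[n]"] that unfolding R_iff by simp
  qed
qed

section \<open>Subsequences of generic sets\<close>

lemma length_initial_segment [simp]: "length (initial_segment A n) = n"
  by (simp add: initial_segment_def)

lemma initial_segment_add:
  "initial_segment A (n + m) = initial_segment A n @ map (\<lambda>i. n + i \<in> A) [0..<m]"
  by (rule nth_equalityI) (auto simp: initial_segment_def nth_append)

lemma prefix_initial_segment:
  assumes "prefix p (initial_segment A n)"
  shows "p = initial_segment A (length p)"
proof -
  have "n = length p + (n - length p)" using prefix_length_le[OF assms] by simp
  then have "initial_segment A n = initial_segment A (length p) @
      map (\<lambda>i. length p + i \<in> A) [0..<n - length p]"
    using initial_segment_add by metis
  with assms show ?thesis by (auto simp: prefix_def)
qed

lemma enumerate_card_less:
  fixes I :: "nat set"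
  assumes "infinite I" "x \<in> I"
  shows "enumerate I (card (I \<inter> {..<x})) = x"
proof -
  obtain k where k: "x = enumerate I k" using enumerate_Ex[OF assms] by metis
  have "I \<inter> {..<enumerate I k} = enumerate I ` {..<k}"
  proof (intro set_eqI iffI)
    fix y assume "y \<in> I \<inter> {..<enumerate I k}"
    then obtain j where "y = enumerate I j" "enumerate I j < enumerate I k"
      using enumerate_Ex[OF assms(1), of y] by auto
    then show "y \<in> enumerate I ` {..<k}" using assms(1) by auto
  qed (auto simp: assms(1) enumerate_in_set)
  then have "card (I \<inter> {..<x}) = k"
    using assms(1) k by (simp add: card_image inj_on_def inj_enumerate[THEN inj_eq])
  with k show ?thesis by simp
qed

text \<open>
A block of consecutive positions contained in \<open>I\<close> is copied unchanged into the \<open>I\<close>-subsequence. The part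
of \<open>G\<close> before it leaves some string \<open>\<mu>\<close> that depends on \<open>I\<close>, of which only the bound on the length is known.
\<close>

lemma initial_segment_subsequence_block:
  assumes I: "infinite I" "{n..<n + m} \<subseteq> I"
    and G: "initial_segment G (n + m) = \<sigma> @ \<rho>" "length \<sigma> = n" "length \<rho> = m"
  obtains \<mu> where "length \<mu> \<le> n" "initial_segment (subsequence I G) (length \<mu> + m) = \<mu> @ \<rho>"
proof -
  define j where "j = card (I \<inter> {..<n})"
  have "j \<le> n" unfolding j_def using card_mono[of "{..<n}" "I \<inter> {..<n}"] by simp
  have "enumerate I (j + i) = n + i" if "i < m" for i
  proof -
    have "I \<inter> {..<n + i} = (I \<inter> {..<n}) \<union> {n..<n + i}" using I(2) that by auto
    then have "card (I \<inter> {..<n + i}) = j + i"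
      unfolding j_def by (simp add: card_Un_disjoint disjoint_iff)
    then show ?thesis
      using enumerate_card_less[OF I(1), of "n + i"] subsetD[OF I(2), of "n + i"] that by simp
  qed
  then have "map (\<lambda>i. j + i \<in> subsequence I G) [0..<m] = map (\<lambda>i. n + i \<in> G) [0..<m]"
    by (simp add: subsequence_def)
  also have "\<dots> = \<rho>" using G unfolding initial_segment_add by simp
  finally have "initial_segment (subsequence I G) (j + m) = initial_segment (subsequence I G) j @ \<rho>"
    unfolding initial_segment_add by simp
  with \<open>j \<le> n\<close> show ?thesis by (intro that[of "initial_segment (subsequence I G) j"]) auto
qed

text \<open>
The c.e. set of strings that forces a generic set to contain a universal suffix at a useful position.
The function \<open>h\<close> enumerates these positions.
\<close>

lemma ce_strings_suffixed:
  assumes r: "total_rec 1 (\<lambda>xs. r (xs ! 0))" and h: "total_rec 1 (\<lambda>xs. h (xs ! 0))"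
  shows "ce_strings {\<sigma> @ bits (r (length \<sigma>)) (r (length \<sigma>)) | \<sigma>. length \<sigma> \<in> range h}"
    (is "ce_strings ?T")
proof -
  have "semidecidable (Suc (Suc 1)) (\<lambda>xs. Suc (xs ! 0) \<le> 2 ^ h (xs ! 1) \<and>
      xs ! 2 = string_code (bits (h (xs ! 1) + r (h (xs ! 1)))
        (xs ! 0 + 2 ^ h (xs ! 1) * r (h (xs ! 1)))))"
    by (intro semidecidable_conj semidecidable_le semidecidable_eq total_rec_string_code_bits
        total_rec_add total_rec_mult total_rec_power total_rec_Suc total_rec_const
        total_rec_unary[OF r] total_rec_unary[OF h] total_rec_nth) auto
  from semidecidable_ex[OF semidecidable_ex[OF this]]
  have "semidecidable 1 (\<lambda>xs. \<exists>k v. Suc v \<le> 2 ^ h k \<and>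
      xs ! 0 = string_code (bits (h k + r (h k)) (v + 2 ^ h k * r (h k))))"
    by (simp add: numeral_2_eq_2)
  then have "semidecidable 1 (\<lambda>xs. xs ! 0 \<in> string_code ` ?T)"
  proof (rule semidecidable_cong)
    (* Strings of length h k are replaced by the numbers v below 2 ^ h k that bits turns into them. *)
    have T: "?T = {bits (h k + r (h k)) (v + 2 ^ h k * r (h k)) | k v. Suc v \<le> 2 ^ h k}"
      (is "_ = ?U")
    proof (intro set_eqI iffI)
      fix \<tau> assume "\<tau> \<in> ?T"
      then obtain \<sigma> k where \<sigma>: "length \<sigma> = h k" "\<tau> = \<sigma> @ bits (r (h k)) (r (h k))" by auto
      obtain v where "v < 2 ^ h k" "bits (h k) v = \<sigma>" using ex_bits[of \<sigma>] \<sigma>(1) by auto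
      then have "Suc v \<le> 2 ^ h k" "\<tau> = bits (h k + r (h k)) (v + 2 ^ h k * r (h k))"
        using \<sigma>(2) bits_append by auto
      then show "\<tau> \<in> ?U" by blast
    next
      fix \<tau> assume "\<tau> \<in> ?U"
      then obtain k v where v: "v < 2 ^ h k" "\<tau> = bits (h k + r (h k)) (v + 2 ^ h k * r (h k))"
        unfolding Suc_le_eq by blast
      then have "\<tau> = bits (h k) v @ bits (r (h k)) (r (h k))" using bits_append by simp
      then show "\<tau> \<in> ?T" by (intro CollectI exI[of _ "bits (h k) v"]) simp
    qed
    show "(\<exists>k v. Suc v \<le> 2 ^ h k \<and>
        xs ! 0 = string_code (bits (h k + r (h k)) (v + 2 ^ h k * r (h k)))) \<longleftrightarrow>
        xs ! 0 \<in> string_code ` ?T" for xs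
      unfolding T by auto
  qed
  then show ?thesis unfolding ce_strings_def ce_set_iff_semidecidable .
qed

text \<open>
The new function \<open>d'\<close> leaves enough space after each of its values for the universal suffix that starts
at the next position. If the complement of \<open>I\<close> is contained in the range of \<open>d'\<close> up to finitely many
elements, then these spaces belong to \<open>I\<close> from some point on. This point depends on \<open>I\<close>, but as it is a
single number \<open>b\<close> the positions beyond it still form a computable set.
\<close>

lemma thin_out:
  assumes S: "dense_strings S" "ce_strings S"
    and d: "total_rec 1 (\<lambda>xs. d (xs ! 0))" "strict_mono d"
  obtains d' where "total_rec 1 (\<lambda>xs. d' (xs ! 0))" "strict_mono d'" "range d' \<subseteq> range d"
    and "\<And>I G. infinite I \<Longrightarrow> finite (- I - range d') \<Longrightarrow> weak_1_generic G \<Longrightarrow>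
      \<exists>n. initial_segment (subsequence I G) n \<in> S"
proof -
  obtain r where r: "total_rec 1 (\<lambda>xs. r (xs ! 0))"
      "\<And>n \<mu>. length \<mu> \<le> n \<Longrightarrow> \<exists>p\<in>S. prefix p (\<mu> @ bits (r n) (r n))"
    using computable_universal_suffix[OF S] by blast
  (* The argument of d is at least the position wanted, and d does not decrease it. *)
  define d' where "d' = rec_nat (d 0) (\<lambda>_ y. d (Suc y + r (Suc y)))"
  have gap: "Suc (d' k) + r (Suc (d' k)) \<le> d' (Suc k)" for k
    using strict_mono_imp_increasing[OF d(2)] by (simp add: d'_def)
  have d'_total: "total_rec 1 (\<lambda>xs. d' (xs ! 0))"
    unfolding d'_def
    by (intro total_rec_rec total_rec_unary[OF d(1)] total_rec_unary[OF r(1)] total_rec_add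
        total_rec_Suc total_rec_const total_rec_nth) auto
  have mono: "strict_mono d'"
    unfolding strict_mono_Suc_iff using gap by (metis add_leE Suc_le_lessD)
  have "d' k \<in> range d" for k by (cases k) (auto simp: d'_def)
  then have range: "range d' \<subseteq> range d" by auto
  have "\<exists>n. initial_segment (subsequence I G) n \<in> S"
    if I: "infinite I" "finite (- I - range d')" and G: "weak_1_generic G" for I G
  proof -
    obtain b where b: "\<And>x. x \<in> - I - range d' \<Longrightarrow> x < b"
      using I(2)[unfolded finite_nat_set_iff_bounded] by blast
    define h where "h k = Suc (d' (k + b))" for k
    have h_ge: "b < h k \<and> k < h k" for k
      using strict_mono_imp_increasing[OF mono, of "k + b"] unfolding h_def by simp
    define T where "T = {\<sigma> @ bits (r (length \<sigma>)) (r (length \<sigma>)) | \<sigma>. length \<sigma> \<in> range h}"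
    have "ce_strings T"
      unfolding T_def
      by (rule ce_strings_suffixed[OF r(1)], unfold h_def)
        (intro total_rec_Suc total_rec_unary[OF d'_total] total_rec_add total_rec_const
          total_rec_nth, auto)
    moreover have "dense_strings T"
      unfolding dense_strings_def
    proof
      fix \<sigma> :: "bool list"
      (* Any string can be padded to one of the useful lengths, as these are unbounded. *)
      define \<sigma>' where "\<sigma>' = \<sigma> @ replicate (h (length \<sigma>) - length \<sigma>) False"
      have "length \<sigma>' = h (length \<sigma>)" unfolding \<sigma>'_def using h_ge[of "length \<sigma>"] by simp
      then have "\<sigma>' @ bits (r (length \<sigma>')) (r (length \<sigma>')) \<in> T" unfolding T_def by blast
      moreover have "prefix \<sigma> (\<sigma>' @ bits (r (length \<sigma>')) (r (length \<sigma>')))"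
        unfolding \<sigma>'_def by simp
      ultimately show "\<exists>\<tau>\<in>T. prefix \<sigma> \<tau>" by blast
    qed
    ultimately obtain N where "initial_segment G N \<in> T" using G unfolding weak_1_generic_def by blast
    then obtain \<sigma> k where \<sigma>: "initial_segment G N = \<sigma> @ bits (r (h k)) (r (h k))" "length \<sigma> = h k"
      unfolding T_def by auto
    have "N = h k + r (h k)" using arg_cong[OF \<sigma>(1), of length] \<sigma>(2) by simp
    have "{h k..<h k + r (h k)} \<subseteq> I"
    proof
      fix x assume x: "x \<in> {h k..<h k + r (h k)}"
      show "x \<in> I"
      proof (rule ccontr)
        assume "x \<notin> I"
        then have "x \<in> range d'" using b[of x] x h_ge[of k] by force
        then obtain l where l: "x = d' l" by blast
        have "d' (k + b) < d' l" "d' l < d' (Suc (k + b))"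
          using x gap[of "k + b"] unfolding l h_def by auto
        then show False using strict_mono_less[OF mono] by auto
      qed
    qed
    from initial_segment_subsequence_block[OF I(1) this \<sigma>(1)[unfolded \<open>N = h k + r (h k)\<close>] \<sigma>(2)]
    obtain \<mu> where \<mu>: "length \<mu> \<le> h k"
      "initial_segment (subsequence I G) (length \<mu> + r (h k)) = \<mu> @ bits (r (h k)) (r (h k))"
      by auto
    obtain p where "p \<in> S" "prefix p (\<mu> @ bits (r (h k)) (r (h k)))" using r(2)[OF \<mu>(1)] by blast
    then show ?thesis using prefix_initial_segment \<mu>(2) by metis
  qed
  with d'_total mono range show ?thesis using that by blast
qed

section \<open>The diagonal construction\<close>

instance recf :: countable by countable_datatype

theorem theorem5p1:
  "\<exists>I :: nat set. \<not> computable_set I \<and> subsequence_set_weak_1_generic I"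
proof -
  (* All c.e. sets of strings occur among the S e, since there are only countably many codes. *)
  define S where "S e = {\<sigma>. rec_eval (from_nat e) [string_code \<sigma>] \<noteq> None}" for e
  have S: "\<exists>e. A = S e" if A: "ce_strings A" for A
  proof -
    obtain f where f: "string_code ` A = {n. rec_eval f [n] \<noteq> None}"
      using A unfolding ce_strings_def ce_set_def by blast
    have "\<sigma> \<in> A \<longleftrightarrow> rec_eval f [string_code \<sigma>] \<noteq> None" for \<sigma>
      using inj_image_mem_iff[OF inj_string_code, of \<sigma> A] unfolding f by blast
    then have "A = S (to_nat f)" unfolding S_def by auto
    then show ?thesis ..
  qed
  let ?forces = "\<lambda>d A. \<forall>I G. infinite I \<longrightarrow> finite (- I - range d) \<longrightarrow> weak_1_generic G \<longrightarrow>
    (\<exists>n. initial_segment (subsequence I G) n \<in> A)"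
  have "\<exists>D :: nat \<Rightarrow> nat \<Rightarrow> nat. \<forall>e. (total_rec 1 (\<lambda>xs. D e (xs ! 0)) \<and> strict_mono (D e)) \<and>
    (range (D (Suc e)) \<subseteq> range (D e) \<and>
      (dense_strings (S e) \<and> ce_strings (S e) \<longrightarrow> ?forces (D (Suc e)) (S e)))"
  proof (rule dependent_nat_choice)
    show "\<exists>d. total_rec 1 (\<lambda>xs. d (xs ! 0)) \<and> strict_mono d"
      by (rule exI[of _ "\<lambda>x. x"]) (simp add: total_rec_nth strict_mono_def)
  next
    fix d e assume d: "total_rec 1 (\<lambda>xs. d (xs ! 0)) \<and> strict_mono d"
    show "\<exists>d'. (total_rec 1 (\<lambda>xs. d' (xs ! 0)) \<and> strict_mono d') \<and> range d' \<subseteq> range d \<and>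
      (dense_strings (S e) \<and> ce_strings (S e) \<longrightarrow> ?forces d' (S e))"
    proof (cases "dense_strings (S e) \<and> ce_strings (S e)")
      case True
      then show ?thesis using thin_out[of "S e" d] d by metis
    qed (use d in blast)
  qed
  then obtain D where D: "\<forall>e. (total_rec 1 (\<lambda>xs. D e (xs ! 0)) \<and> strict_mono (D e)) \<and>
    (range (D (Suc e)) \<subseteq> range (D e) \<and>
      (dense_strings (S e) \<and> ce_strings (S e) \<longrightarrow> ?forces (D (Suc e)) (S e)))" ..
  note mono = D[THEN spec, THEN conjunct1, THEN conjunct2]
  note sub = D[THEN spec, THEN conjunct2, THEN conjunct1]
  note forces = D[THEN spec, THEN conjunct2, THEN conjunct2, THEN mp]
  (* The summand 2 keeps the successor of each p e out of the range of p, so these successors will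
     make I infinite. *)
  define p where "p = rec_nat (D 0 0) (\<lambda>e y. D (Suc e) (y + 2))"
  have p_gap: "p e + 2 \<le> p (Suc e)" for e
    using strict_mono_imp_increasing[OF mono] by (simp add: p_def)
  then have p_mono: "strict_mono p" 
    
    
    
    unfolding strict_mono_Suc_iff by (metis add_2_eq_Suc' Suc_le_lessD Suc_lessD)
  have "p e \<in> range (D e)" for e by (cases e) (auto simp: p_def)
  then have p_range: "p i \<in> range (D e)" if "e \<le> i" for e i
    using lift_Suc_antimono_le[of "\<lambda>e. range (D e)", OF sub that] by blast
  define C where "C e = {n. rec_eval (from_nat e) [n] = Some 1}" for e
  (* I differs from C e at the point p e, and every computable set is some C e. *)
  define I where "I = - p ` {e. p e \<in> C e}"
  have "Suc (p e) \<in> I" for e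
  proof -
    have "Suc (p e) \<noteq> p i" for i
    proof (cases "i \<le> e")
      case True
      then show ?thesis using strict_mono_less_eq[OF p_mono, of i e] by simp
    next
      case False
      then show ?thesis using strict_mono_less_eq[OF p_mono, of "Suc e" i] p_gap[of e] by simp
    qed
    then show ?thesis unfolding I_def by blast
  qed
  then have "range (\<lambda>e. Suc (p e)) \<subseteq> I" by blast
  moreover have "infinite (range (\<lambda>e. Suc (p e)))"
    using strict_mono_imp_inj_on[OF p_mono] by (intro range_inj_infinite) (auto simp: inj_def)
  ultimately have inf: "infinite I" using finite_subset by blast
  have "\<not> computable_set I"
  proof
    assume "computable_set I"
    then obtain f where f: "\<And>n. rec_eval f [n] = Some (of_bool (n \<in> I))"
      unfolding computable_set_def by blast
    then have "C (to_nat f) = I" unfolding C_def by auto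
    moreover have "p (to_nat f) \<in> I \<longleftrightarrow> p (to_nat f) \<notin> C (to_nat f)"
      unfolding I_def using strict_mono_eq[OF p_mono] by auto
    ultimately show False by blast
  qed
  moreover have "weak_1_generic (subsequence I G)" if G: "weak_1_generic G" for G
    unfolding weak_1_generic_def
  proof (intro allI impI)
    fix A assume A: "dense_strings A \<and> ce_strings A"
    obtain e where e: "A = S e" using S A by blast
    have "i \<le> e" if "p i \<notin> range (D (Suc e))" for i
      using p_range[of "Suc e" i] that not_less_eq_eq by blast
    then have "- I - range (D (Suc e)) \<subseteq> p ` {..e}" unfolding I_def by blast
    then have "finite (- I - range (D (Suc e)))" by (rule finite_subset) simp
    then show "\<exists>n. initial_segment (subsequence I G) n \<in> A"
      using forces[of e, OF A[unfolded e]] inf G unfolding e by blast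
  qed
  ultimately show ?thesis using inf unfolding subsequence_set_weak_1_generic_def by blast
qed

end
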